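(* Let $X$ be a topological space and let $\mathcal{F}$ be a nonempty subset of $\mathbb{H}_{ft}(X)$ which is bounded from below, i.e. there is $\psi\in\mathbb{H}_{ft}(X)$ with $\psi\le f$ for all $f\in\mathcal{F}$. Then there exists $v\in\mathbb{H}_{ft}(X)$ such that $v=\inf\mathcal{F}$, where the infimum is taken in the partially ordered set $(\mathbb{H}_{ft}(X),\le)$.
   Context: Let $\overline{\mathbb{R}}=\mathbb{R}\cup\{\pm\infty\}$ and let $\mathbb{I}\overline{\mathbb{R}}=\{[\underline a,\overline a]:\underline a,\overline a\in\overline{\mathbb{R}},\ \underline a\le\overline a\}$ be the set of closed intervals $[\underline a,\overline a]=\{z\in\overline{\mathbb R}:\underline a\le z\le\overline a\}$, partially ordered by $[\underline a,\overline a]\le[\underline b,\overline b]\iff \underline a\le\underline b$ and $\overline a\le\overline b$. A point $x\in\overline{\mathbb{R}}$ is identified with $[x,x]$. For a topological space $X$ let $\mathbb{A}(X)$ be the set of all functions $f:X\to\mathbb{I}\overline{\mathbb{R}}$, ordered pointwise: $f\le g\iff f(x)\le g(x)$ for all $x\in X$. Let $\mathcal{A}(X)\subset\mathbb{A}(X)$ be the set of functions $X\to\overline{\mathbb{R}}$. With $\mathcal{V}_x$ the set of neighborhoods of $x$, define for $f\in\mathbb{A}(X)$ the functions $I(f),S(f)\in\mathcal{A}(X)$ and $F(f)\in\mathbb{A}(X)$ by $I(f)(x)=\sup_{V\in\mathcal{V}_x}\inf\{z\in f(y):y\in V\}$, $S(f)(x)=\inf_{V\in\mathcal{V}_x}\sup\{z\in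 f(y):y\in V\}$, $F(f)(x)=[I(f)(x),S(f)(x)]$. A function $f\in\mathbb{A}(X)$ is Hausdorff continuous (H-continuous) if for every $g\in\mathbb{A}(X)$ with $g(x)\subseteq f(x)$ for all $x\in X$ one has $F(g)(x)=f(x)$ for all $x\in X$. $\mathbb{H}(X)$ is the set of all H-continuous functions on $X$, and $\mathbb{H}_{ft}(X)=\{f\in\mathbb{H}(X): f(x)\subseteq\mathbb{R}\text{ for all }x\in X\}$, with the order induced from $\mathbb{A}(X)$. *)

theory Defs
  imports "HOL-Analysis.Analysis" "HOL-Library.Interval"
begin

text \<open>
  Elements of \<^typ>\<open>ereal interval\<close> are the nonempty closed intervals with endpoints in the
  extended reals, and \<^const>\<open>set_of\<close> gives the corresponding set of points.
  The library order on \<^typ>\<open>ereal interval\<close> is inclusion; the endpointwise order needed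
  here is therefore introduced under a separate name, and so is the pointwise order on functions.
\<close>

definition interval_le :: "ereal interval \<Rightarrow> ereal interval \<Rightarrow> bool"  (infix \<open>\<le>\<^sub>I\<close> 50)
  where "a \<le>\<^sub>I b \<longleftrightarrow> lower a \<le> lower b \<and> upper a \<le> upper b"

definition ifun_le :: "('a \<Rightarrow> ereal interval) \<Rightarrow> ('a \<Rightarrow> ereal interval) \<Rightarrow> bool"  (infix \<open>\<preceq>\<close> 50)
  where "f \<preceq> g \<longleftrightarrow> (\<forall>x. f x \<le>\<^sub>I g x)"

text \<open>Neighborhoods need not be open.\<close>

definition neighborhoods :: "'a::topological_space \<Rightarrow> 'a set set"
  where "neighborhoods x = {V. \<exists>U. open U \<and> x \<in> U \<and> U \<subseteq> V}"

definition lower_baire :: "('a::topological_space \<Rightarrow> ereal interval) \<Rightarrow> 'a \<Rightarrow> ereal"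
  where "lower_baire f x = (SUP V\<in>neighborhoods x. Inf (\<Union>y\<in>V. set_of (f y)))"

definition upper_baire :: "('a::topological_space \<Rightarrow> ereal interval) \<Rightarrow> 'a \<Rightarrow> ereal"
  where "upper_baire f x = (INF V\<in>neighborhoods x. Sup (\<Union>y\<in>V. set_of (f y)))"

lemma lower_baire_le_upper_baire: "lower_baire f x \<le> upper_baire f x"
  unfolding lower_baire_def upper_baire_def
proof (intro SUP_least INF_greatest)
  fix V W assume "V \<in> neighborhoods x" "W \<in> neighborhoods x"
  then have "x \<in> V" "x \<in> W" by (auto simp: neighborhoods_def)
  moreover have "lower (f x) \<in> set_of (f x)" by (simp add: set_of_eq)
  ultimately have "lower (f x) \<in> (\<Union>y\<in>V. set_of (f y))" "lower (f x) \<in> (\<Union>y\<in>W. set_of (f y))"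
    by blast+
  then show "Inf (\<Union>y\<in>V. set_of (f y)) \<le> Sup (\<Union>y\<in>W. set_of (f y))"
    by (meson Inf_lower Sup_upper order_trans)
qed

definition graph_completion ::
    "('a::topological_space \<Rightarrow> ereal interval) \<Rightarrow> 'a \<Rightarrow> ereal interval"
  where "graph_completion f x = Interval (lower_baire f x, upper_baire f x)"

text \<open>
  The constructor \<^const>\<open>Interval\<close> is only specified on ordered pairs of endpoints, so
  the definition above relies on \<open>lower_baire_le_upper_baire\<close>.
\<close>

lemma lower_graph_completion [simp]: "lower (graph_completion f x) = lower_baire f x"
  and upper_graph_completion [simp]: "upper (graph_completion f x) = upper_baire f x"
  by (simp_all add: graph_completion_def lower.rep_eq upper.rep_eq Interval_inverse
      lower_baire_le_upper_baire)

definition hausdorff_continuous :: "('a::topological_space \<Rightarrow> ereal interval) \<Rightarrow> bool"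
  where "hausdorff_continuous f \<longleftrightarrow>
    (\<forall>g. (\<forall>x. set_of (g x) \<subseteq> set_of (f x)) \<longrightarrow> (\<forall>x. graph_completion g x = f x))"

definition H_ft :: "('a::topological_space \<Rightarrow> ereal interval) set"
  where "H_ft = {f. hausdorff_continuous f \<and> (\<forall>x. set_of (f x) \<subseteq> range ereal)}"

definition is_inf_in ::
    "('a \<Rightarrow> ereal interval) set \<Rightarrow> ('a \<Rightarrow> ereal interval) set \<Rightarrow> ('a \<Rightarrow> ereal interval) \<Rightarrow> bool"
  where "is_inf_in P A v \<longleftrightarrow>
    v \<in> P \<and> (\<forall>f\<in>A. v \<preceq> f) \<and> (\<forall>w\<in>P. (\<forall>f\<in>A. w \<preceq> f) \<longrightarrow> w \<preceq> v)"

end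

theory Submission
  imports Defs
begin

text \<open>
  Write \<open>I\<close> and \<open>S\<close> for the lower and upper envelopes of a point-valued function; both are
  monotone and idempotent, with \<open>I \<phi> \<le> \<phi> \<le> S \<phi>\<close>. An interval function \<open>[l, u]\<close> is Hausdorff
  continuous exactly if \<open>I u = l\<close> and \<open>S l = u\<close> (\<open>hausdorff_continuous_iff\<close>), so each endpoint
  determines the other through a monotone operator. Hence only one endpoint needs attention
  when comparing Hausdorff continuous functions.

  Let \<open>\<phi>\<close> be the pointwise infimum of the upper endpoints of the members of \<open>\<F>\<close>. It is upper
  semicontinuous, \<open>S \<phi> = \<phi>\<close>, but \<open>[I \<phi>, \<phi>]\<close> is in general too wide: the right candidate is
  \<open>[I \<phi>, S (I \<phi>)]\<close>. It is Hausdorff continuous because \<open>I \<phi> \<le> S (I \<phi>) \<le> \<phi>\<close> forces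
  \<open>I (S (I \<phi>)) = I \<phi>\<close>. Monotonicity of \<open>I\<close> and \<open>S\<close> makes it the greatest lower bound of \<open>\<F>\<close>
  among all Hausdorff continuous functions. Finiteness is then automatic, since the infimum
  lies between a finite lower bound and any member of \<open>\<F>\<close>.
\<close>

definition lower_envelope :: "('a::topological_space \<Rightarrow> 'b::complete_lattice) \<Rightarrow> 'a \<Rightarrow> 'b"
  where "lower_envelope \<phi> x = (SUP V\<in>neighborhoods x. INF y\<in>V. \<phi> y)"

definition upper_envelope :: "('a::topological_space \<Rightarrow> 'b::complete_lattice) \<Rightarrow> 'a \<Rightarrow> 'b"
  where "upper_envelope \<phi> x = (INF V\<in>neighborhoods x. SUP y\<in>V. \<phi> y)"

lemma mem_neighborhoods: "V \<in> neighborhoods x \<Longrightarrow> x \<in> V"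
  by (auto simp: neighborhoods_def)

lemma open_in_neighborhoods: "open U \<Longrightarrow> x \<in> U \<Longrightarrow> U \<in> neighborhoods x"
  by (auto simp: neighborhoods_def)

lemma lower_envelope_le: "lower_envelope \<phi> \<le> \<phi>"
  unfolding lower_envelope_def le_fun_def
  by (auto intro!: SUP_least intro: INF_lower mem_neighborhoods)

lemma le_upper_envelope: "\<phi> \<le> upper_envelope \<phi>"
  unfolding upper_envelope_def le_fun_def
  by (auto intro!: INF_greatest intro: SUP_upper mem_neighborhoods)

lemma lower_envelope_mono: "\<phi> \<le> \<rho> \<Longrightarrow> lower_envelope \<phi> \<le> lower_envelope \<rho>"
  unfolding lower_envelope_def le_fun_def
  by (auto intro!: SUP_mono' INF_superset_mono)

lemma upper_envelope_mono: "\<phi> \<le> \<rho> \<Longrightarrow> upper_envelope \<phi> \<le> upper_envelope \<rho>"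
  unfolding upper_envelope_def le_fun_def
  by (auto intro!: INF_mono' SUP_subset_mono)

text \<open>
  An open neighborhood of \<open>x\<close> is a neighborhood of each of its points, so a bound for \<open>\<phi>\<close> on
  it is also a bound for the envelope of \<open>\<phi>\<close> on it.
\<close>

lemma lower_envelope_idem [simp]:
  "lower_envelope (lower_envelope \<phi>) = lower_envelope \<phi>"
proof (rule antisym[OF lower_envelope_le], rule le_funI)
  fix x
  have "(INF y\<in>V. \<phi> y) \<le> lower_envelope (lower_envelope \<phi>) x" if "V \<in> neighborhoods x" for V
  proof -
    from that obtain U where U: "open U" "x \<in> U" "U \<subseteq> V"
      by (auto simp: neighborhoods_def)
    have "(INF y\<in>V. \<phi> y) \<le> (INF z\<in>U. lower_envelope \<phi> z)"
    proof (rule INF_greatest)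
      fix z assume "z \<in> U"
      have "(INF y\<in>V. \<phi> y) \<le> (INF y\<in>U. \<phi> y)"
        using U by (intro INF_superset_mono) auto
      also have "\<dots> \<le> lower_envelope \<phi> z"
        unfolding lower_envelope_def
        by (rule SUP_upper) (rule open_in_neighborhoods[OF \<open>open U\<close> \<open>z \<in> U\<close>])
      finally show "(INF y\<in>V. \<phi> y) \<le> lower_envelope \<phi> z" .
    qed
    also have "\<dots> \<le> lower_envelope (lower_envelope \<phi>) x"
      unfolding lower_envelope_def[of "lower_envelope \<phi>"]
      by (rule SUP_upper) (rule open_in_neighborhoods[OF U(1,2)])
    finally show ?thesis .
  qed
  then show "lower_envelope \<phi> x \<le> lower_envelope (lower_envelope \<phi>) x"
    unfolding lower_envelope_def[of \<phi> x] by (rule SUP_least)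
qed

lemma upper_envelope_idem [simp]:
  "upper_envelope (upper_envelope \<phi>) = upper_envelope \<phi>"
proof (rule antisym[OF _ le_upper_envelope], rule le_funI)
  fix x
  have "upper_envelope (upper_envelope \<phi>) x \<le> (SUP y\<in>V. \<phi> y)" if "V \<in> neighborhoods x" for V
  proof -
    from that obtain U where U: "open U" "x \<in> U" "U \<subseteq> V"
      by (auto simp: neighborhoods_def)
    have "upper_envelope (upper_envelope \<phi>) x \<le> (SUP z\<in>U. upper_envelope \<phi> z)"
      unfolding upper_envelope_def[of "upper_envelope \<phi>"]
      by (rule INF_lower) (rule open_in_neighborhoods[OF U(1,2)])
    also have "\<dots> \<le> (SUP y\<in>V. \<phi> y)"
    proof (rule SUP_least)
      fix z assume "z \<in> U"
      have "upper_envelope \<phi> z \<le> (SUP y\<in>U. \<phi> y)"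
        unfolding upper_envelope_def
        by (rule INF_lower) (rule open_in_neighborhoods[OF \<open>open U\<close> \<open>z \<in> U\<close>])
      also have "\<dots> \<le> (SUP y\<in>V. \<phi> y)"
        using U by (intro SUP_subset_mono) auto
      finally show "upper_envelope \<phi> z \<le> (SUP y\<in>V. \<phi> y)" .
    qed
    finally show ?thesis .
  qed
  then show "upper_envelope (upper_envelope \<phi>) x \<le> upper_envelope \<phi> x"
    unfolding upper_envelope_def[of \<phi> x] by (rule INF_greatest)
qed

lemma lower_baire_eq_lower_envelope: "lower_baire f = lower_envelope (\<lambda>x. lower (f x))"
proof -
  have "Inf (\<Union>y\<in>V. set_of (f y)) = (INF y\<in>V. lower (f y))" for V
    by (rule antisym)
      (force intro!: INF_greatest Inf_greatest intro: Inf_lower INF_lower2 simp: set_of_eq)+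
  then show ?thesis
    by (simp add: fun_eq_iff lower_baire_def lower_envelope_def)
qed

lemma upper_baire_eq_upper_envelope: "upper_baire f = upper_envelope (\<lambda>x. upper (f x))"
proof -
  have "Sup (\<Union>y\<in>V. set_of (f y)) = (SUP y\<in>V. upper (f y))" for V
    by (rule antisym)
      (force intro!: SUP_least Sup_least intro: Sup_upper SUP_upper2 simp: set_of_eq)+
  then show ?thesis
    by (simp add: fun_eq_iff upper_baire_def upper_envelope_def)
qed

text \<open>
  For the forward direction, the definition is tested on the two point-valued selections
  \<open>l\<close> and \<open>u\<close> of \<open>f = [l, u]\<close>. Conversely, these are the extreme selections: any \<open>g\<close> inside
  \<open>f\<close> has lower envelope between \<open>I l\<close> and \<open>I u\<close>, which agree by idempotence, and likewise above.
\<close>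

lemma hausdorff_continuous_iff:
  "hausdorff_continuous f \<longleftrightarrow>
    lower_envelope (\<lambda>x. upper (f x)) = (\<lambda>x. lower (f x)) \<and>
    upper_envelope (\<lambda>x. lower (f x)) = (\<lambda>x. upper (f x))"
    (is "_ \<longleftrightarrow> lower_envelope ?u = ?l \<and> upper_envelope ?l = ?u")
proof (intro iffI conjI)
  assume f: "hausdorff_continuous f"
  have "graph_completion (\<lambda>x. interval_of (?u x)) = f"
    using f unfolding hausdorff_continuous_def fun_eq_iff
    by (elim allE) (erule mp, simp add: set_of_eq)
  then have "lower_baire (\<lambda>x. interval_of (?u x)) = ?l"
    by (metis lower_graph_completion)
  then show "lower_envelope ?u = ?l"
    by (simp add: lower_baire_eq_lower_envelope)
  have "graph_completion (\<lambda>x. interval_of (?l x)) = f"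
    using f unfolding hausdorff_continuous_def fun_eq_iff
    by (elim allE) (erule mp, simp add: set_of_eq)
  then have "upper_baire (\<lambda>x. interval_of (?l x)) = ?u"
    by (metis upper_graph_completion)
  then show "upper_envelope ?l = ?u"
    by (simp add: upper_baire_eq_upper_envelope)
next
  assume "lower_envelope ?u = ?l \<and> upper_envelope ?l = ?u"
  then have lu: "lower_envelope ?u = ?l" and ul: "upper_envelope ?l = ?u"
    by auto
  have ll: "lower_envelope ?l = ?l"
    using lower_envelope_idem[of ?u] lu by simp
  have uu: "upper_envelope ?u = ?u"
    using upper_envelope_idem[of ?l] ul by simp
  show "hausdorff_continuous f"
    unfolding hausdorff_continuous_def
  proof (intro allI impI)
    fix g x
    assume "\<forall>x. set_of (g x) \<subseteq> set_of (f x)"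
    then have bounds: "?l y \<le> lower (g y)" "lower (g y) \<le> ?u y"
        "?l y \<le> upper (g y)" "upper (g y) \<le> ?u y" for y
      by (simp_all add: set_of_eq subset_eq lower_le_upper)
    have "lower_envelope (\<lambda>x. lower (g x)) = ?l"
      using lower_envelope_mono[of ?l "\<lambda>x. lower (g x)"]
        lower_envelope_mono[of "\<lambda>x. lower (g x)" ?u] ll lu bounds
      by (auto intro!: antisym simp: le_fun_def)
    moreover have "upper_envelope (\<lambda>x. upper (g x)) = ?u"
      using upper_envelope_mono[of ?l "\<lambda>x. upper (g x)"]
        upper_envelope_mono[of "\<lambda>x. upper (g x)" ?u] ul uu bounds
      by (auto intro!: antisym simp: le_fun_def)
    ultimately show "graph_completion g x = f x"
      by (simp add: interval_eq_iff lower_baire_eq_lower_envelope upper_baire_eq_upper_envelope)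
  qed
qed

text \<open>
  The points of \<open>v x\<close> are squeezed between two real numbers, the lower endpoint of \<open>\<psi> x\<close> and
  the upper endpoint of \<open>f x\<close>.
\<close>

lemma H_ft_between:
  assumes "hausdorff_continuous v" "\<psi> \<in> H_ft" "f \<in> H_ft" "\<psi> \<preceq> v" "v \<preceq> f"
  shows "v \<in> H_ft"
proof -
  have "set_of (v x) \<subseteq> range ereal" for x
  proof
    fix z assume z: "z \<in> set_of (v x)"
    have "lower (\<psi> x) \<in> set_of (\<psi> x)" "upper (f x) \<in> set_of (f x)"
      by (simp_all add: set_of_eq)
    then have "lower (\<psi> x) \<in> range ereal" "upper (f x) \<in> range ereal"
      using assms(2,3) unfolding H_ft_def by blast+
    moreover have "lower (\<psi> x) \<le> z" "z \<le> upper (f x)"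
      using assms(4,5) z
      by (auto simp: ifun_le_def interval_le_def set_of_eq intro: order_trans)
    ultimately show "z \<in> range ereal"
      by (cases z) auto
  qed
  with assms(1) show ?thesis by (simp add: H_ft_def)
qed

text \<open>
  Among all Hausdorff continuous functions, with infinite values permitted, infima exist
  unconditionally. Separating this from the question of finiteness means that the latter can
  be settled afterwards by comparison alone.
\<close>

lemma hausdorff_continuous_Inf_exists:
  assumes \<F>: "\<And>f. f \<in> \<F> \<Longrightarrow> hausdorff_continuous f"
  obtains v where "is_inf_in (Collect hausdorff_continuous) \<F> v"
proof -
  define \<phi> where "\<phi> x = (INF f\<in>\<F>. upper (f x))" for x
  \<comment> \<open>By idempotence, the completion of the point-valued function \<open>I \<phi>\<close> is \<open>[I \<phi>, S (I \<phi>)]\<close>.\<close>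
  define v where "v = graph_completion (\<lambda>x. interval_of (lower_envelope \<phi> x))"
  have lower_v: "(\<lambda>x. lower (v x)) = lower_envelope \<phi>"
    and upper_v: "(\<lambda>x. upper (v x)) = upper_envelope (lower_envelope \<phi>)"
    by (simp_all add: v_def lower_baire_eq_lower_envelope upper_baire_eq_upper_envelope)
  have \<phi>_le: "\<phi> \<le> (\<lambda>x. upper (f x))" if "f \<in> \<F>" for f
    using that by (auto simp: \<phi>_def le_fun_def intro: INF_lower)
  \<comment> \<open>An infimum of upper semicontinuous functions is upper semicontinuous.\<close>
  have "upper_envelope \<phi> \<le> \<phi>"
  proof (rule le_funI)
    fix x
    have "upper_envelope \<phi> x \<le> upper (f x)" if f: "f \<in> \<F>" for f
    proof -
      have "upper_envelope (\<lambda>x. upper (f x)) = (\<lambda>x. upper (f x))"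
        using \<F>[OF f] unfolding hausdorff_continuous_iff by (metis upper_envelope_idem)
      with upper_envelope_mono[OF \<phi>_le[OF f]] show ?thesis
        by (simp add: le_fun_def)
    qed
    then show "upper_envelope \<phi> x \<le> \<phi> x"
      unfolding \<phi>_def by (rule INF_greatest)
  qed
  then have upper_v_le: "upper_envelope (lower_envelope \<phi>) \<le> \<phi>"
    using upper_envelope_mono[OF lower_envelope_le] by (rule order_trans[rotated])
  have "hausdorff_continuous v"
    unfolding hausdorff_continuous_iff lower_v upper_v
    using lower_envelope_mono[OF upper_v_le]
      lower_envelope_mono[OF le_upper_envelope[of "lower_envelope \<phi>"]]
    by (auto intro: antisym)
  moreover have "v \<preceq> f" if f: "f \<in> \<F>" for f
  proof -
    have "lower_envelope \<phi> \<le> (\<lambda>x. lower (f x))"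
      using lower_envelope_mono[OF \<phi>_le[OF f]] \<F>[OF f] by (simp add: hausdorff_continuous_iff)
    moreover have "upper_envelope (lower_envelope \<phi>) \<le> (\<lambda>x. upper (f x))"
      using upper_v_le \<phi>_le[OF f] by (rule order_trans)
    ultimately show ?thesis
      unfolding ifun_le_def interval_le_def
      using lower_v upper_v by (simp add: le_fun_def fun_eq_iff)
  qed
  moreover have "w \<preceq> v" if w: "hausdorff_continuous w" and le: "\<forall>f\<in>\<F>. w \<preceq> f" for w
  proof -
    have "(\<lambda>x. upper (w x)) \<le> \<phi>"
      using le by (auto simp: \<phi>_def le_fun_def ifun_le_def interval_le_def intro: INF_greatest)
    from lower_envelope_mono[OF this] have "(\<lambda>x. lower (w x)) \<le> lower_envelope \<phi>"
      using w by (simp add: hausdorff_continuous_iff)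
    moreover from upper_envelope_mono[OF this]
    have "(\<lambda>x. upper (w x)) \<le> upper_envelope (lower_envelope \<phi>)"
      using w by (simp add: hausdorff_continuous_iff)
    ultimately show ?thesis
      unfolding ifun_le_def interval_le_def
      using lower_v upper_v by (simp add: le_fun_def fun_eq_iff)
  qed
  ultimately show thesis
    by (intro that[of v]) (auto simp: is_inf_in_def)
qed

theorem theorem6:
  fixes \<F> :: "('a::topological_space \<Rightarrow> ereal interval) set"
  assumes "\<F> \<noteq> {}"
    and "\<F> \<subseteq> H_ft"
    and "\<exists>\<psi>\<in>H_ft. \<forall>f\<in>\<F>. \<psi> \<preceq> f"
  shows "\<exists>v\<in>H_ft. is_inf_in H_ft \<F> v"
proof -
  have H_ftD: "hausdorff_continuous f" if "f \<in> H_ft" for f :: "'a \<Rightarrow> ereal interval"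
    using that by (simp add: H_ft_def)
  obtain v where v: "is_inf_in (Collect hausdorff_continuous) \<F> v"
    using assms(2) H_ftD by (blast intro: hausdorff_continuous_Inf_exists)
  obtain f \<psi> where "f \<in> \<F>" and \<psi>: "\<psi> \<in> H_ft" "\<forall>f\<in>\<F>. \<psi> \<preceq> f"
    using assms(1,3) by blast
  then have "v \<in> H_ft"
    using v assms(2) H_ftD
    by (intro H_ft_between[of v \<psi> f]) (auto simp: is_inf_in_def)
  moreover from this v have "is_inf_in H_ft \<F> v"
    using H_ftD by (auto simp: is_inf_in_def)
  ultimately show ?thesis by blast
qed

end
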